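(* Let $n\ge 1$ and $0\le p\le n$ be integers. Then, as an identity of formal power series in $y$, $$\sum_{k\ge 1}\binom{n}{p}_k\,y^k=n\,y\,(y+1)^p\;{}_2F_1\!\left[\begin{matrix}p+1,\;p-n+1\\ 2\end{matrix};-y\right].$$
   Context: For $a$ a number and $r\ge 0$ an integer, $(a)_r=a(a+1)\cdots(a+r-1)$ denotes the raising factorial, with $(a)_0=1$. The Gauss hypergeometric series is ${}_2F_1\!\left[\begin{matrix}a,b\\ c\end{matrix};z\right]=\sum_{j\ge 0}\frac{(a)_j(b)_j}{(c)_j}\frac{z^j}{j!}$. For integers $n\ge 1$, $0\le p\le n$, $k\ge 0$, define $$\binom{n}{p}_k=\binom{n}{k}\;{}_3F_2\!\left[\begin{matrix}1-k,\,-p,\,p-n\\ 1-n,\,1\end{matrix};1\right]=\binom{n}{k}\sum_{r=0}^{\min(p,n-p)}\frac{(1-k)_r\,(-p)_r\,(p-n)_r}{(1-n)_r\,(1)_r\,r!}.$$ The sum is finite because $(-p)_r(p-n)_r=0$ for $r>\min(p,n-p)$, and the denominators are nonzero in the stated range. Here $\binom{n}{k}$ is the usual binomial coefficient, equal to $0$ for $k>n$; hence $\binom{n}{p}_k=0$ for $k>n$. *)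

theory Defs
  imports "HOL-Computational_Algebra.Formal_Power_Series"
begin

text \<open>
  The generalized binomial coefficient with upper entries \<open>n\<close>, \<open>p\<close> and index \<open>k\<close>, namely
  \<open>(n choose k)\<close> times the value at 1 of the terminating series 3F2 with numerator parameters
  \<open>1 - k\<close>, \<open>-p\<close>, \<open>p - n\<close> and denominator parameters \<open>1 - n\<close>, \<open>1\<close>.
  It is meant for \<open>n \<ge> 1\<close> and \<open>p \<le> n\<close>.  The explicit bound on \<open>r\<close> is needed: later
  terms have a vanishing numerator, but from \<open>r = n\<close> on also a vanishing denominator.
  The arguments are embedded into the field before subtracting, so no subtraction is truncated
  except in the summation bound, where \<open>p \<le> n\<close>.
\<close>

definition gen_binomial :: "nat \<Rightarrow> nat \<Rightarrow> nat \<Rightarrow> 'a::field_char_0" where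
  "gen_binomial n p k =
     of_nat (n choose k) *
     (\<Sum>r = 0..min p (n - p).
        (pochhammer (1 - of_nat k) r * pochhammer (- of_nat p) r * pochhammer (of_nat p - of_nat n) r) /
        (pochhammer (1 - of_nat n) r * pochhammer 1 r * fact r))"

end

theory Submission
  imports Defs
begin

unbundle fps_syntax

text \<open>
  Put \<open>m = n - p\<close>.  Both sides have vanishing constant term, so it suffices to compare their
  derivatives, multiplied by \<open>1 + y\<close>.  On the left, \<open>k\<close> times the \<open>k\<close>-th coefficient is
  \<open>n \<Sum>\<^sub>r (p choose r) (m choose r) (n-1-r choose k-1-r)\<close>, so the derivative is
  \<open>n \<Sum>\<^sub>r (p choose r) (m choose r) y\<^sup>r (1+y)\<^sup>n\<^sup>-\<^sup>1\<^sup>-\<^sup>r\<close>.  On the right, a contiguous relation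
  gives \<open>n (1+y)\<^sup>p\<^sup>-\<^sup>1 \<Sum>\<^sub>j (m choose j) (p+j choose j) y\<^sup>j\<close>.  The two agree by the Pfaff
  transformation, which for these parameters is Vandermonde's identity.
\<close>

lemma pochhammer_minus_of_nat:
  "pochhammer (- of_nat a :: 'a::field_char_0) r = (- 1) ^ r * fact r * of_nat (a choose r)"
proof -
  have "of_nat (a choose r) = (-1) ^ r * pochhammer (- of_nat a :: 'a) r / fact r"
    by (simp add: binomial_gbinomial gbinomial_pochhammer)
  then show ?thesis by (simp add: power_mult_distrib[symmetric])
qed

lemma pochhammer_of_nat_Suc:
  "pochhammer (of_nat p + 1 :: 'a::field_char_0) j = fact j * of_nat (p + j choose j)"
proof -
  have "of_nat (p + j choose j) = pochhammer (of_nat (p + j) - of_nat j + 1 :: 'a) j / fact j"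
    by (simp add: binomial_gbinomial gbinomial_pochhammer' del: of_nat_add)
  then show ?thesis by simp
qed

lemma fps_nth_one_plus_X_power:
  "((1 + fps_X) ^ n :: 'a::field_char_0 fps) $ k = of_nat (n choose k)"
proof (induction n arbitrary: k)
  case (Suc n)
  then show ?case by (cases k) (simp_all add: fps_mult_fps_X_plus_1_nth)
qed simp

text \<open>Signs and factorials cancel in the quotient, leaving
  \<open>(k choose r) / (N choose r)\<close>; then trinomial revision applies. The bound
  \<open>r \<le> N\<close> keeps the denominator nonzero.\<close>

lemma choose_ratio:
  assumes "r \<le> N"
  shows "of_nat (N choose k) * pochhammer (- of_nat k) r / pochhammer (- of_nat N) r =
    (if r \<le> k then of_nat (N - r choose (k - r)) else 0 :: 'a::field_char_0)"
proof -
  have pos: "(of_nat (N choose r) :: 'a) \<noteq> 0" using assms by simp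
  consider "r > k" | "r \<le> k" "k > N" | "r \<le> k" "k \<le> N" by linarith
  then show ?thesis
  proof cases
    case 3
    have "of_nat (N choose k) * of_nat (k choose r) =
        (of_nat (N choose r) * of_nat (N - r choose (k - r)) :: 'a)"
      using choose_mult[OF 3] by (metis of_nat_mult)
    then show ?thesis using 3 pos by (simp add: pochhammer_minus_of_nat field_simps)
  qed (use assms in \<open>auto simp: pochhammer_minus_of_nat binomial_eq_0\<close>)
qed

text \<open>The factor \<open>Suc k\<close> is absorbed to lower the upper entry \<open>n\<close> to
  \<open>n - 1\<close>, which matches the denominator parameter \<open>1 - n\<close>, so that
  \<open>choose_ratio\<close> applies term by term.\<close>

lemma Suc_times_gen_binomial:
  fixes p m k :: nat
  assumes "n = p + m" and "n \<ge> 1"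
  shows "of_nat (Suc k) * gen_binomial n p (Suc k) =
    (of_nat n * (\<Sum>r\<le>min p m. of_nat ((p choose r) * (m choose r)) *
      (if r \<le> k then of_nat (n - 1 - r choose (k - r)) else 0)) :: 'a::field_char_0)"
proof -
  obtain N where N: "n = Suc N" using assms(2) by (cases n) auto
  have absorb: "of_nat (Suc k) * of_nat (n choose Suc k) = (of_nat n * of_nat (N choose k) :: 'a)"
    using Suc_times_binomial_eq[of N k] unfolding N by (metis mult.commute of_nat_mult)
  have diff: "n - p = m" "(of_nat p - of_nat n :: 'a) = - of_nat m"
    "(1 - of_nat n :: 'a) = - of_nat N" "(1 - of_nat (Suc k) :: 'a) = - of_nat k"
    by (simp_all add: assms(1)) (simp add: assms(1)[symmetric] N flip: of_nat_add)
  have "of_nat (Suc k) * gen_binomial n p (Suc k) =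
    (\<Sum>r\<le>min p m. of_nat n * (of_nat (N choose k) * 
        ((pochhammer (- of_nat k) r * pochhammer (- of_nat p) r * pochhammer (- of_nat m) r) /
        (pochhammer (- of_nat N) r * pochhammer 1 r * fact r))) :: 'a)"
    unfolding gen_binomial_def diff mult.assoc[symmetric] absorb
    by (simp add: sum_distrib_left atLeast0AtMost mult.assoc)
  also have "\<dots> = (\<Sum>r\<le>min p m. of_nat n * (of_nat ((p choose r) * (m choose r)) *
      (if r \<le> k then of_nat (n - 1 - r choose (k - r)) else 0)))"
  proof (intro sum.cong refl, rule arg_cong2[where f = "(*)", OF refl])
    fix r assume "r \<in> {..min p m}"
    \<comment> \<open>If \<open>r\<close> were at least \<open>n\<close>, both \<open>p\<close> and
      \<open>m\<close> would be at least \<open>n\<close>, contradicting \<open>n = p + m\<close>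
      with \<open>n \<ge> 1\<close>.\<close>
    then have r: "r \<le> N" using assms N by auto
    \<comment> \<open>The two signs \<open>(-1) ^ r\<close> coming from \<open>p\<close> and
      \<open>m\<close> cancel, and their two factorials cancel
      \<open>pochhammer 1 r * fact r\<close>.\<close>
    have "of_nat (N choose k) * 
        ((pochhammer (- of_nat k) r * pochhammer (- of_nat p) r * pochhammer (- of_nat m) r) /
        (pochhammer (- of_nat N) r * pochhammer 1 r * fact r)) =
        of_nat ((p choose r) * (m choose r)) * 
        (of_nat (N choose k) * pochhammer (- of_nat k) r / pochhammer (- of_nat N) r :: 'a)"
      by (simp add: pochhammer_minus_of_nat[of p] pochhammer_minus_of_nat[of m]
        pochhammer_fact[symmetric] power_mult_distrib[symmetric])
    also have "\<dots> = of_nat ((p choose r) * (m choose r)) *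
      (if r \<le> k then of_nat (n - 1 - r choose (k - r)) else 0)"
      unfolding choose_ratio[OF r] by (simp add: N)
    finally show "of_nat (N choose k) * 
        ((pochhammer (- of_nat k) r * pochhammer (- of_nat p) r * pochhammer (- of_nat m) r) /
        (pochhammer (- of_nat N) r * pochhammer 1 r * fact r)) =
        (of_nat ((p choose r) * (m choose r)) *
      (if r \<le> k then of_nat (n - 1 - r choose (k - r)) else 0) :: 'a)" .
  qed
  finally show ?thesis by (simp add: sum_distrib_left)
qed

text \<open>Vandermonde expands \<open>p + j choose j\<close>; trinomial revision then moves the
  factor \<open>m choose j\<close> into each term.\<close>

lemma choose_mult_sum:
  "(m choose j) * (p + j choose j) =
    (\<Sum>r\<le>min p m. (p choose r) * (m choose r) * (if r \<le> j then m - r choose (j - r) else 0))"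
proof (cases "j \<le> m")
  case True
  have "(m choose j) * (p + j choose j) = (\<Sum>r\<le>j. (m choose j) * ((p choose r) * (j choose (j - r))))"
    by (simp add: vandermonde[symmetric] sum_distrib_left)
  also have "\<dots> = (\<Sum>r\<le>j. (p choose r) * (m choose r) * (if r \<le> j then m - r choose (j - r) else 0))"
  proof (intro sum.cong refl)
    fix r assume r: "r \<in> {..j}"
    then have "(m choose j) * (j choose (j - r)) = (m choose r) * (m - r choose (j - r))"
      using True choose_mult[of r j m] by (simp add: binomial_symmetric[symmetric])
    then show "(m choose j) * ((p choose r) * (j choose (j - r))) =
        (p choose r) * (m choose r) * (if r \<le> j then m - r choose (j - r) else 0)"
      using r by simp
  qed
  also have "\<dots> = (\<Sum>r\<le>min p m. (p choose r) * (m choose r) * (if r \<le> j then m - r choose (j - r) else 0))"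
    \<comment> \<open>Terms with \<open>r > p\<close> vanish through \<open>p choose r\<close>,
      those with \<open>r > j\<close> through the conditional; \<open>r \<le> j\<close> forces
      \<open>r \<le> m\<close>.\<close>
    using True by (intro sum.mono_neutral_cong) auto
  finally show ?thesis .
\<comment> \<open>For \<open>j > m\<close> every term is zero, since \<open>m - r < j - r\<close>
  when \<open>r \<le> m\<close>.\<close>
qed (auto simp: binomial_eq_0 intro!: sum.neutral[symmetric])

text \<open>Pfaff's transformation of 2F1(p+1, -m; 1; -y) into (1+y)^m 2F1(-p, -m; 1; y/(1+y)), with
  the powers of 1+y cleared from the denominators.\<close>

lemma pfaff_fps:
  "Abs_fps (\<lambda>j. of_nat ((m choose j) * (p + j choose j))) =
    (\<Sum>r\<le>min p m. of_nat ((p choose r) * (m choose r)) * (fps_X ^ r * (1 + fps_X) ^ (m - r))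
      :: 'a::field_char_0 fps)"
proof (rule fps_ext)
  fix j
  show "Abs_fps (\<lambda>j. of_nat ((m choose j) * (p + j choose j))) $ j =
    (\<Sum>r\<le>min p m. of_nat ((p choose r) * (m choose r)) * (fps_X ^ r * (1 + fps_X) ^ (m - r))
      :: 'a fps) $ j"
    unfolding choose_mult_sum
    by (auto simp: fps_sum_nth fps_X_power_mult_nth
        fps_nth_one_plus_X_power simp del: of_nat_mult intro!: sum.cong)
       (auto)
qed

text \<open>The operator is (1+y)^(1-p) d/dy (1+y)^p. It lowers the parameters 1-m and 2 by one,
  giving 2F1(p+1, -m; 1; -y).\<close>

lemma contiguous_fps:
  fixes m p :: nat
  defines "G \<equiv> fps_X * fps_hypergeo [of_nat p + 1, 1 - of_nat m] [2] (- 1 :: 'a::field_char_0)"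
  shows "(1 + fps_X) * fps_deriv G + of_nat p * G =
    Abs_fps (\<lambda>j. of_nat ((m choose j) * (p + j choose j)))"
proof (rule fps_ext)
  fix j
  define g :: "nat \<Rightarrow> 'a" where
    "g i = pochhammer (of_nat p + 1) i * pochhammer (1 - of_nat m) i * (- 1) ^ i
      / (fact (Suc i) * fact i)" for i
  have two: "pochhammer 2 i = (fact (Suc i) :: 'a)" for i
    using pochhammer_rec[of "1::'a" i] by (simp add: pochhammer_fact)
  have G: "G $ Suc i = g i" for i
    by (simp add: G_def g_def two)
  have G0: "G $ 0 = 0" by (simp add: G_def)
  have rhs: "of_nat ((m choose j) * (p + j choose j)) =
     pochhammer (of_nat p + 1) j * pochhammer (- of_nat m) j * (- 1) ^ j / (fact j * fact j :: 'a)"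
    by (simp add: pochhammer_of_nat_Suc pochhammer_minus_of_nat power_mult_distrib[symmetric])
  \<comment> \<open>The factor \<open>fps_X\<close> shifts indices, so \<open>G $ j\<close> is
    \<open>g (j - 1)\<close> except at \<open>j = 0\<close>, where it is 0.\<close>
  have "of_nat (Suc j) * g j + (if j = 0 then 0 else of_nat (j + p) * g (j - 1)) =
     pochhammer (of_nat p + 1) j * pochhammer (- of_nat m) j * (- 1) ^ j / (fact j * fact j :: 'a)"
  proof (cases j)
    case (Suc i)
    define d :: 'a where "d = of_nat (Suc i)"
    have nz: "d \<noteq> 0" "d + 1 \<noteq> 0"
      unfolding d_def using of_nat_neq_0[of i, where ?'a = 'a] of_nat_neq_0[of "Suc i", where ?'a = 'a]
      by (auto simp: add_ac)
    \<comment> \<open>Apart from common factors this is \<open>d - (d - m') = m'\<close>. The factor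
      \<open>d - m'\<close> is the last one of
      \<open>pochhammer (1 - of_nat m) (Suc i)\<close>.\<close>
    have "(d + 1) * (A * (p' + d) * (B * (d - m')) * (- s) / ((d + 1) * (d * F) * (d * F))) +
        (d + p') * (A * B * s / (d * F * F)) = A * (p' + d) * (- m' * B) * (- s) / (d * F * (d * F))"
      if "F \<noteq> 0" for A B F s p' m' :: 'a
      using nz that by (simp add: divide_simps) (simp add: algebra_simps)
    from this[of "fact i" "pochhammer (of_nat p + 1) i" "of_nat p" "pochhammer (1 - of_nat m) i"
        "of_nat m" "(-1) ^ i"]
    have "(d + 1) * g (Suc i) + (d + of_nat p) * g i =
        pochhammer (of_nat p + 1) (Suc i) * (- of_nat m * pochhammer (1 - of_nat m) i)
          * (- 1) ^ Suc i / (fact (Suc i) * fact (Suc i))"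
      by (simp add: g_def pochhammer_Suc d_def algebra_simps)
    moreover have "pochhammer (- of_nat m :: 'a) (Suc i) = - of_nat m * pochhammer (1 - of_nat m) i"
      by (simp add: pochhammer_rec algebra_simps)
    ultimately show ?thesis
      by (simp add: Suc d_def add_ac)
  qed (simp add: g_def)
  then show "((1 + fps_X) * fps_deriv G + of_nat p * G) $ j =
      Abs_fps (\<lambda>j. of_nat ((m choose j) * (p + j choose j))) $ j"
    unfolding fps_nth_Abs_fps rhs
    by (cases j) (auto simp: G G0 algebra_simps)
qed

theorem theorem3:
  fixes n p :: nat
  assumes "n \<ge> 1" and "p \<le> n"
  shows "Abs_fps (\<lambda>k. if k \<ge> 1 then gen_binomial n p k else (0 :: 'a :: field_char_0)) =
           of_nat n * fps_X * (fps_X + 1) ^ p *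
           fps_hypergeo [of_nat p + 1, of_nat p - of_nat n + 1] [2] (- 1)"
    (is "?L = ?R")
proof -
  define m where "m = n - p"
  have n: "n = p + m" using assms by (simp add: m_def)
  define G where "G = fps_X * fps_hypergeo [of_nat p + 1, 1 - of_nat m] [2] (- 1 :: 'a)"
  define K where "K = (\<Sum>r\<le>min p m. of_nat ((p choose r) * (m choose r)) *
    (fps_X ^ r * (1 + fps_X) ^ (m - r)) :: 'a fps)"
  have R: "?R = of_nat n * ((1 + fps_X) ^ p * G)"
    by (simp add: G_def n algebra_simps)
  have K: "(1 + fps_X) * fps_deriv G + of_nat p * G = K"
    unfolding K_def G_def pfaff_fps[symmetric] contiguous_fps ..
  \<comment> \<open>The factor 1+y restores the exponent lowered by differentiation, so that
    \<open>p = 0\<close> fits the same formula.\<close>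
  have pow: "(1 + fps_X) * fps_deriv ((1 + fps_X) ^ p) = of_nat p * ((1 + fps_X) ^ p :: 'a fps)"
    unfolding fps_deriv_power' by (cases p) (simp_all add: mult_ac del: of_nat_Suc)
  have "(1 + fps_X) * fps_deriv ?R =
      of_nat n * ((1 + fps_X) ^ p * ((1 + fps_X) * fps_deriv G) +
        (1 + fps_X) * fps_deriv ((1 + fps_X) ^ p) * G)"
    unfolding R by (simp add: algebra_simps)
  also have "\<dots> = of_nat n * ((1 + fps_X) ^ p * K)"
    unfolding pow K[symmetric] by (simp add: algebra_simps)
  finally have dR: "(1 + fps_X) * fps_deriv ?R = of_nat n * ((1 + fps_X) ^ p * K)" .
  have "fps_deriv ?L = of_nat n * (\<Sum>r\<le>min p m. of_nat ((p choose r) * (m choose r)) *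
    (fps_X ^ r * (1 + fps_X) ^ (n - 1 - r)))" (is "_ = _ * ?S")
  proof (rule fps_ext)
    fix k
    have "fps_deriv ?L $ k = of_nat (Suc k) * gen_binomial n p (Suc k)" by simp
    also have "\<dots> = (of_nat n * ?S) $ k"
      unfolding Suc_times_gen_binomial[OF n assms(1)]
      by (auto simp: fps_sum_nth fps_X_power_mult_nth
        fps_nth_one_plus_X_power simp del: of_nat_mult intro!: sum.cong)
    finally show "fps_deriv ?L $ k = (of_nat n * ?S) $ k" .
  qed
  moreover have "(1 + fps_X) * ?S = (1 + fps_X) ^ p * K"
    unfolding K_def sum_distrib_left
  proof (intro sum.cong refl)
    fix r assume "r \<in> {..min p m}"
    \<comment> \<open>Here \<open>r < n\<close>, so \<open>n - 1 - r\<close> is not truncated, and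
      one extra factor 1+y splits off exactly the power \<open>p\<close>.\<close>
    then have "Suc (n - 1 - r) = p + (m - r)" using assms n by auto
    then have "(1 + fps_X) * (1 + fps_X) ^ (n - 1 - r) =
        ((1 + fps_X) ^ p * (1 + fps_X) ^ (m - r) :: 'a fps)"
      by (metis power_Suc power_add)
    then show "(1 + fps_X) * (of_nat ((p choose r) * (m choose r)) *
        (fps_X ^ r * (1 + fps_X) ^ (n - 1 - r))) =
      ((1 + fps_X) ^ p * (of_nat ((p choose r) * (m choose r)) *
        (fps_X ^ r * (1 + fps_X) ^ (m - r))) :: 'a fps)"
      by (simp add: mult.left_commute mult.assoc)
  qed
  ultimately have "(1 + fps_X) * fps_deriv ?L = (1 + fps_X) * fps_deriv ?R"
    unfolding dR by (simp add: mult.left_commute)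
  moreover have "(1 + fps_X :: 'a fps) \<noteq> 0"
    by (auto simp: fps_eq_iff intro!: exI[of _ 0])
  ultimately have "fps_deriv ?L = fps_deriv ?R" by simp
  then show ?thesis unfolding fps_deriv_eq_iff by simp
qed

end
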